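(* Let $\Psi_{\Theta,\gamma}$ be the joint reconstruction and synthesis objective $$\Psi_{\Theta,\gamma}(\mathbf{x}_1,\mathbf{x}_2,\mathbf{x}_3)=\sum_{i=1}^{2}\tfrac12\|P_iF\mathbf{x}_i-\mathbf{f}_i\|_2^2+\sum_{i=1}^{3}\|h_{w_i}(\mathbf{x}_i)\|_{2,1}+\tfrac{\gamma}{2}\|g_\theta([h_{w_1}(\mathbf{x}_1),h_{w_2}(\mathbf{x}_2)])-\mathbf{x}_3\|_2^2,$$ with $h_{w_i}$, $g_\theta$, $P_i$, $F$, $\mathbf{f}_i$ as in the context, and write $\mathbf{X}=(\mathbf{x}_1,\mathbf{x}_2,\mathbf{x}_3)$. Assume $\Psi_{\Theta,\gamma}$ is coercive and $\min_{\mathbf{X}}\Psi_{\Theta,\gamma}(\mathbf{X})>-\infty$. Suppose $\{\mathbf{X}^{(t)}\}$ is the sequence generated by the Algorithm described in the context with any initial $\mathbf{X}^{(0)}$, $\epsilon_{\mathrm{tol}}=0$ and $T=\infty$. Let $\{\mathbf{X}^{(t_l+1)}\}_{l=1,2,\dots}$ be the subsequence of iterates satisfying the reduction criterion of the Algorithm, i.e. $\|\nabla\Psi_{\varepsilon_t}(\mathbf{X}^{(t+1)})\|<\sigma\eta\varepsilon_t$ for $t=t_l$. Then $\{\mathbf{X}^{(t_l+1)}\}$ has at least one accumulation point, and every accumulation point of $\{\mathbf{X}^{(t_l+1)}\}$ is a Clarke stationary point of $\min_{\mathbf{X}}\Psi_{\Theta,\gamma}(\mathbf{X})$.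
   Context: Here $\mathbf{x}_i\in\mathbb{C}^n$ are images, $F$ is the discrete Fourier transform, $P_i$ is a binary undersampling matrix, $\mathbf{f}_i$ ($i=1,2$) is given partial k-space data, and $\gamma>0$ is a fixed weight. All complex spaces are identified with real Euclidean spaces (real and imaginary parts), and gradients and Clarke subdifferentials are taken in this real sense. A point $\hat{\mathbf{X}}$ is Clarke stationary for $\Psi_{\Theta,\gamma}$ if $0$ belongs to the Clarke subdifferential of $\Psi_{\Theta,\gamma}$ at $\hat{\mathbf{X}}$. Networks. $h_{w_i}:\mathbb{C}^n\to\mathbb{C}^{m\times d}$ is a bias-free convolutional network $h_{w_i}(\mathbf{x})=\mathbf{c}_{w_i,l}*\varphi(\cdots\varphi(\mathbf{c}_{w_i,2}*\varphi(\mathbf{c}_{w_i,1}*\mathbf{x})))$, where each convolution $\mathbf{c}_{w_i,q}*(\cdot)$ is a linear map with fixed weights. $h_{w_i,j}(\mathbf{x})\in\mathbb{C}^d$, $j=1,\dots,m$, denotes the feature vector at spatial position $j$, and $\|h_{w_i}(\mathbf{x})\|_{2,1}=\sum_{j=1}^m\|h_{w_i,j}(\mathbf{x})\|$. $g_\theta:\mathbb{C}^{m\times 2d}\to\mathbb{C}^n$ is a bias-free convolutional network of the same form with fixed weights $\mathbf{c}_{\theta,q}$, and $[\cdot,\cdot]$ denotes concatenation along channels. $\Theta=\{w_1,w_2,w_3,\theta\}$ is fixed. The activation $\varphi$ acts componentwise (on real and imaginary parts) and is the continuously differentiable smoothed rectified linear unit: for a fixed $\delta>0$, $\varphi(x)=0$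 if $x\le-\delta$, $\varphi(x)=\frac{1}{4\delta}x^2+\frac12x+\frac{\delta}{4}$ if $-\delta<x<\delta$, and $\varphi(x)=x$ if $x\ge\delta$. Smoothing. For $\varepsilon>0$, $\Psi_\varepsilon=\Psi^{\varepsilon}_{\Theta,\gamma}$ is obtained from $\Psi_{\Theta,\gamma}$ by replacing each $\|h_{w_i}(\mathbf{x}_i)\|_{2,1}$ with $\|h_{w_i}(\mathbf{x}_i)\|_{\varepsilon_{2,1}}=\sum_{j=1}^m\big(\sqrt{\|h_{w_i,j}(\mathbf{x}_i)\|^2+\varepsilon^2}-\varepsilon\big)$. Algorithm. Input: initial $\mathbf{X}^{(0)}$; constants $0<\rho,\eta<1$ and $\varepsilon_0,a,\sigma>0$; maximal number of phases $T$ or tolerance $\epsilon_{\mathrm{tol}}\ge0$; step sizes $\alpha_t>0$. For $t=0,1,2,\dots,T-1$: 1. Compute $\mathbf{V}^{(t+1)}=\mathbf{X}^{(t)}-\alpha_t\nabla\Psi_{\varepsilon_t}(\mathbf{X}^{(t)})$. If $\Psi_{\varepsilon_t}(\mathbf{V}^{(t+1)})-\Psi_{\varepsilon_t}(\mathbf{X}^{(t)})\le-\frac1a\|\mathbf{V}^{(t+1)}-\mathbf{X}^{(t)}\|^2$, set $\mathbf{X}^{(t+1)}=\mathbf{V}^{(t+1)}$; otherwise replace $\alpha_t$ by $\rho\alpha_t$ and repeat step 1. 2. (Reduction criterion) If $\|\nabla\Psi_{\varepsilon_t}(\mathbf{X}^{(t+1)})\|<\sigma\eta\varepsilon_t$,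 set $\varepsilon_{t+1}=\eta\varepsilon_t$; otherwise set $\varepsilon_{t+1}=\varepsilon_t$. 3. If $\sigma\varepsilon_t<\epsilon_{\mathrm{tol}}$, terminate. *)

theory Defs
  imports "HOL-Analysis.Analysis"
begin

section \<open>Networks\<close>

definition srelu :: "real \<Rightarrow> real \<Rightarrow> real" where
  "srelu \<delta> x =
     (if x \<le> - \<delta> then 0
      else if x < \<delta> then x\<^sup>2 / (4 * \<delta>) + x / 2 + \<delta> / 4
      else x)"

definition csrelu :: "real \<Rightarrow> complex \<Rightarrow> complex" where
  "csrelu \<delta> z = Complex (srelu \<delta> (Re z)) (srelu \<delta> (Im z))"

text \<open>
  Hidden layers of a network may have different numbers of positions and channels, so they
  are represented by functions of a position and a channel number.
\<close>
type_synonym fmap = "nat \<Rightarrow> nat \<Rightarrow> complex"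

text \<open>
  A multi-channel convolution.  The weight of output channel \<open>b\<close>, input channel \<open>c\<close> and kernel
  offset \<open>k\<close> is shared by all positions; \<open>tap q k\<close> is the input position that the kernel
  offset \<open>k\<close> reaches when the kernel is centred at output position \<open>q\<close>, and \<open>None\<close> stands for
  zero padding.  Dimension of the grid, stride, dilation and kind of padding are thus
  arbitrary.
\<close>
record conv =
  in_pos :: nat
  in_chan :: nat
  out_pos :: nat
  out_chan :: nat
  offsets :: nat
  tap :: "nat \<Rightarrow> nat \<Rightarrow> nat option"
  weight :: "nat \<Rightarrow> nat \<Rightarrow> nat \<Rightarrow> complex"

definition conv_ok :: "conv \<Rightarrow> bool" where
  "conv_ok c \<longleftrightarrow>
     (\<forall>q < out_pos c. \<forall>k < offsets c. \<forall>p. tap c q k = Some p \<longrightarrow> p < in_pos c)"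

definition convolve :: "conv \<Rightarrow> fmap \<Rightarrow> fmap" where
  "convolve c u q b =
     (\<Sum>k<offsets c. case tap c q k of
         None \<Rightarrow> 0
       | Some p \<Rightarrow> \<Sum>i<in_chan c. weight c b i k * u p i)"

text \<open>
  \<open>conv_chain p c ws p' c'\<close>: the layers \<open>ws\<close> (first layer first) are composable and lead from
  \<open>p\<close> positions with \<open>c\<close> channels to \<open>p'\<close> positions with \<open>c'\<close> channels.
\<close>
fun conv_chain :: "nat \<Rightarrow> nat \<Rightarrow> conv list \<Rightarrow> nat \<Rightarrow> nat \<Rightarrow> bool" where
  "conv_chain p c [] p' c' \<longleftrightarrow> p = p' \<and> c = c'"
| "conv_chain p c (w # ws) p' c' \<longleftrightarrow>
     conv_ok w \<and> in_pos w = p \<and> in_chan w = c \<and> conv_chain (out_pos w) (out_chan w) ws p' c'"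

text \<open>The activation is applied between consecutive layers, not after the last one.\<close>
fun layers :: "real \<Rightarrow> conv list \<Rightarrow> fmap \<Rightarrow> fmap" where
  "layers \<delta> [] u = u"
| "layers \<delta> [w] u = convolve w u"
| "layers \<delta> (w # w' # ws) u =
     layers \<delta> (w' # ws) (\<lambda>p i. csrelu \<delta> (convolve w u p i))"

text \<open>
  Positions and channels of the typed feature spaces are numbered by \<^const>\<open>to_nat_on\<close>.  The
  choice of the numbering is immaterial, since taps and weights are arbitrary.
\<close>
definition num :: "'a::finite \<Rightarrow> nat" where
  "num = to_nat_on UNIV"

definition to_fmap :: "complex^'c::finite^'p::finite \<Rightarrow> fmap" where
  "to_fmap u = (\<lambda>p c. if p < CARD('p) \<and> c < CARD('c)
                      then u $ inv num p $ inv num c else 0)"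

definition conv_net ::
    "real \<Rightarrow> conv list \<Rightarrow> complex^'c::finite^'p::finite \<Rightarrow> complex^'d::finite^'q::finite" where
  "conv_net \<delta> ws u = (\<chi> q d. layers \<delta> ws (to_fmap u) (num q) (num d))"

text \<open>Images are feature maps with a single channel.\<close>

definition feature_net ::
    "real \<Rightarrow> conv list \<Rightarrow> complex^'n::finite \<Rightarrow> complex^'d::finite^'m::finite" where
  "feature_net \<delta> ws x = conv_net \<delta> ws ((\<chi> i _. x $ i) :: complex^1^'n)"

definition synthesis_net ::
    "real \<Rightarrow> conv list \<Rightarrow> complex^'e::finite^'m::finite \<Rightarrow> complex^'n::finite" where
  "synthesis_net \<delta> ws u = (\<chi> i. (conv_net \<delta> ws u :: complex^1^'n) $ i $ 1)"

definition is_feature_net ::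
    "real \<Rightarrow> conv list \<Rightarrow> (complex^'n::finite \<Rightarrow> complex^'d::finite^'m::finite) \<Rightarrow> bool" where
  "is_feature_net \<delta> ws h \<longleftrightarrow>
     ws \<noteq> [] \<and> conv_chain CARD('n) 1 ws CARD('m) CARD('d) \<and> h = feature_net \<delta> ws"

definition is_synthesis_net ::
    "real \<Rightarrow> conv list \<Rightarrow> (complex^'e::finite^'m::finite \<Rightarrow> complex^'n::finite) \<Rightarrow> bool" where
  "is_synthesis_net \<delta> ws g \<longleftrightarrow>
     ws \<noteq> [] \<and> conv_chain CARD('m) CARD('e) ws CARD('n) 1 \<and> g = synthesis_net \<delta> ws"

definition concat_channels ::
    "complex^'d::finite^'m::finite \<Rightarrow> complex^'d^'m \<Rightarrow> complex^('d + 'd)^'m" where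
  "concat_channels u v = (\<chi> j c. case c of Inl a \<Rightarrow> u $ j $ a | Inr b \<Rightarrow> v $ j $ b)"


section \<open>Objective\<close>

text \<open>
  \<open>pix\<close> gives the grid coordinates of a pixel (and of a frequency) of an image with \<open>N\<^sub>1\<close> rows
  and \<open>N\<^sub>2\<close> columns.  One-dimensional signals are the case \<open>N\<^sub>2 = 1\<close>.
\<close>
definition pixel_grid :: "nat \<Rightarrow> nat \<Rightarrow> ('n::finite \<Rightarrow> nat \<times> nat) \<Rightarrow> bool" where
  "pixel_grid N\<^sub>1 N\<^sub>2 pix \<longleftrightarrow> bij_betw pix UNIV ({..<N\<^sub>1} \<times> {..<N\<^sub>2})"

definition dft ::
    "nat \<Rightarrow> nat \<Rightarrow> ('n::finite \<Rightarrow> nat \<times> nat) \<Rightarrow> complex^'n \<Rightarrow> complex^'n" where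
  "dft N\<^sub>1 N\<^sub>2 pix x =
     (\<chi> k. \<Sum>j\<in>UNIV.
        cis (- 2 * pi * (real (fst (pix j)) * real (fst (pix k)) / real N\<^sub>1
                       + real (snd (pix j)) * real (snd (pix k)) / real N\<^sub>2)) * x $ j)"

text \<open>
  Both usual forms are covered: the selection matrix, whose rows are distinct rows of the
  identity, and the diagonal 0/1 mask.
\<close>
definition undersampling :: "complex^'n::finite^'k::finite \<Rightarrow> bool" where
  "undersampling P \<longleftrightarrow>
     (\<forall>r c. P $ r $ c \<in> {0, 1}) \<and>
     (\<forall>r c c'. P $ r $ c = 1 \<longrightarrow> P $ r $ c' = 1 \<longrightarrow> c = c') \<and>
     (\<forall>r r' c. P $ r $ c = 1 \<longrightarrow> P $ r' $ c = 1 \<longrightarrow> r = r')"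

definition norm21 :: "complex^'d::finite^'m::finite \<Rightarrow> real" where
  "norm21 u = (\<Sum>j\<in>UNIV. norm (u $ j))"

definition smooth_norm21 :: "real \<Rightarrow> complex^'d::finite^'m::finite \<Rightarrow> real" where
  "smooth_norm21 \<epsilon> u = (\<Sum>j\<in>UNIV. sqrt ((norm (u $ j))\<^sup>2 + \<epsilon>\<^sup>2) - \<epsilon>)"

type_synonym 'n images = "(complex^'n) \<times> (complex^'n) \<times> (complex^'n)"

text \<open>The argument \<open>N\<close> is the regularizer on features, either the (2,1)-norm or its smoothing.\<close>
definition joint_objective ::
    "(complex^'d::finite^'m::finite \<Rightarrow> real) \<Rightarrow> (complex^'n::finite \<Rightarrow> complex^'n) \<Rightarrow>
     complex^'n^'k1::finite \<Rightarrow> complex^'n^'k2::finite \<Rightarrow> complex^'k1 \<Rightarrow> complex^'k2 \<Rightarrow>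
     (complex^'n \<Rightarrow> complex^'d^'m) \<Rightarrow> (complex^'n \<Rightarrow> complex^'d^'m) \<Rightarrow>
     (complex^'n \<Rightarrow> complex^'d^'m) \<Rightarrow> (complex^('d + 'd)^'m \<Rightarrow> complex^'n) \<Rightarrow>
     real \<Rightarrow> 'n images \<Rightarrow> real" where
  "joint_objective N F P\<^sub>1 P\<^sub>2 f\<^sub>1 f\<^sub>2 h\<^sub>1 h\<^sub>2 h\<^sub>3 g \<gamma> = (\<lambda>(x\<^sub>1, x\<^sub>2, x\<^sub>3).
     (norm (P\<^sub>1 *v F x\<^sub>1 - f\<^sub>1))\<^sup>2 / 2 + (norm (P\<^sub>2 *v F x\<^sub>2 - f\<^sub>2))\<^sup>2 / 2
     + (N (h\<^sub>1 x\<^sub>1) + N (h\<^sub>2 x\<^sub>2) + N (h\<^sub>3 x\<^sub>3))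
     + \<gamma> / 2 * (norm (g (concat_channels (h\<^sub>1 x\<^sub>1) (h\<^sub>2 x\<^sub>2)) - x\<^sub>3))\<^sup>2)"


section \<open>Variational notions\<close>

text \<open>
  The inner product of \<^typ>\<open>complex\<close> and of the vector and product types built from it is the
  real one, so this is the gradient with respect to real and imaginary parts.
\<close>
definition grad :: "('a::real_inner \<Rightarrow> real) \<Rightarrow> 'a \<Rightarrow> 'a" where
  "grad f x = (THE v. GDERIV f x :> v)"

definition clarke_dir_deriv :: "('a::real_normed_vector \<Rightarrow> real) \<Rightarrow> 'a \<Rightarrow> 'a \<Rightarrow> ereal" where
  "clarke_dir_deriv f x d =
     Limsup (nhds x \<times>\<^sub>F at_right 0) (\<lambda>(y, s). ereal ((f (y + s *\<^sub>R d) - f y) / s))"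

definition clarke_subdifferential :: "('a::real_inner \<Rightarrow> real) \<Rightarrow> 'a \<Rightarrow> 'a set" where
  "clarke_subdifferential f x = {v. \<forall>d. ereal (v \<bullet> d) \<le> clarke_dir_deriv f x d}"

definition clarke_stationary :: "('a::real_inner \<Rightarrow> real) \<Rightarrow> 'a \<Rightarrow> bool" where
  "clarke_stationary f x \<longleftrightarrow> 0 \<in> clarke_subdifferential f x"

definition accumulation_point :: "(nat \<Rightarrow> 'a::topological_space) \<Rightarrow> 'a \<Rightarrow> bool" where
  "accumulation_point Y y \<longleftrightarrow> (\<exists>r. strict_mono r \<and> (Y \<circ> r) \<longlonglongrightarrow> y)"


section \<open>Algorithm\<close>

definition sufficient_decrease :: "('a::real_inner \<Rightarrow> real) \<Rightarrow> real \<Rightarrow> 'a \<Rightarrow> 'a \<Rightarrow> bool" where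
  "sufficient_decrease f a x v \<longleftrightarrow> f v - f x \<le> - (1 / a) * (norm (v - x))\<^sup>2"

text \<open>\<open>k\<close> is the number of times the trial step size \<open>\<alpha>\<close> is multiplied by \<open>\<rho>\<close>.\<close>
definition line_search ::
    "('a::real_inner \<Rightarrow> real) \<Rightarrow> real \<Rightarrow> real \<Rightarrow> real \<Rightarrow> 'a \<Rightarrow> 'a \<Rightarrow> bool" where
  "line_search f \<rho> a \<alpha> x x' \<longleftrightarrow>
     (\<exists>k. x' = x - (\<rho> ^ k * \<alpha>) *\<^sub>R grad f x \<and> sufficient_decrease f a x x' \<and>
          (\<forall>i<k. \<not> sufficient_decrease f a x (x - (\<rho> ^ i * \<alpha>) *\<^sub>R grad f x)))"

definition reduction_criterion ::
    "(real \<Rightarrow> 'a::real_inner \<Rightarrow> real) \<Rightarrow> real \<Rightarrow> real \<Rightarrow> (nat \<Rightarrow> 'a) \<Rightarrow> (nat \<Rightarrow> real) \<Rightarrow> nat \<Rightarrow> bool"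
  where
  "reduction_criterion \<Phi> \<eta> \<sigma> X \<epsilon> t \<longleftrightarrow>
     norm (grad (\<Phi> (\<epsilon> t)) (X (Suc t))) < \<sigma> * \<eta> * \<epsilon> t"

text \<open>
  \<open>\<Phi> \<epsilon>\<close> is the objective smoothed with parameter \<open>\<epsilon>\<close>.  Phase \<open>t\<close> is executed if \<open>t < T\<close> and no
  earlier phase has met the termination test; nothing is required of the sequences after
  termination.
\<close>
definition algorithm_run ::
    "(real \<Rightarrow> 'a::real_inner \<Rightarrow> real) \<Rightarrow> real \<Rightarrow> real \<Rightarrow> real \<Rightarrow> real \<Rightarrow> real \<Rightarrow> (nat \<Rightarrow> real) \<Rightarrow>
     real \<Rightarrow> enat \<Rightarrow> (nat \<Rightarrow> 'a) \<Rightarrow> (nat \<Rightarrow> real) \<Rightarrow> bool" where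
  "algorithm_run \<Phi> \<rho> \<eta> \<epsilon>\<^sub>0 a \<sigma> \<alpha> \<epsilon>tol T X \<epsilon> \<longleftrightarrow>
     \<epsilon> 0 = \<epsilon>\<^sub>0 \<and>
     (\<forall>t. enat t < T \<and> (\<forall>s<t. \<not> \<sigma> * \<epsilon> s < \<epsilon>tol) \<longrightarrow>
        line_search (\<Phi> (\<epsilon> t)) \<rho> a (\<alpha> t) (X t) (X (Suc t)) \<and>
        \<epsilon> (Suc t) = (if reduction_criterion \<Phi> \<eta> \<sigma> X \<epsilon> t then \<eta> * \<epsilon> t else \<epsilon> t))"

end

theory Submission
  imports Defs
begin

text \<open>
  The objective has the form \<open>\<phi> + (\<Sum>i\<in>I. norm (H i))\<close> with finitely many continuously
  differentiable maps \<open>\<phi>\<close> and \<open>H i\<close>: the index \<open>i\<close> runs through pairs of an image and a spatial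
  position, and smoothness of the networks follows by composition, because the activation is
  continuously differentiable.  The smoothing replaces each \<open>norm (H i)\<close> by
  \<open>sqrt ((norm (H i))\<^sup>2 + \<epsilon>\<^sup>2) - \<epsilon>\<close>.

  Boundedness of the iterates (\<open>obj_bounded_along_run\<close>): the smoothed objective plus
  \<open>card I * \<epsilon>\<close> is nondecreasing in \<open>\<epsilon>\<close> and lies above the nonsmooth objective.  Its value at
  \<open>X t\<close> with parameter \<open>\<epsilon> t\<close> does not increase along a run, so all iterates lie in a sublevel
  set of the objective, which is bounded by coercivity.  Accumulation points therefore exist.

  Infinitely many reductions (\<open>infinitely_many_reductions\<close>): otherwise \<open>\<epsilon>\<close> is eventually constant
  and the gradients stay away from \<open>0\<close>.  On a bounded set uniform continuity of the gradient makes
  the line search accept all sufficiently short steps (\<open>short_steps_accepted\<close>).  As the initial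
  trial steps are bounded away from \<open>0\<close>, so are the accepted ones, and every later phase lowers one
  fixed smooth function, which is bounded below, by at least a fixed amount.

  Stationarity (\<open>smoothing_limit_stationary\<close>): let \<open>Y k\<close> tend to \<open>x\<close> and \<open>e k\<close> to \<open>0\<close>, with
  gradients at \<open>Y k\<close> of the objective smoothed with \<open>e k\<close> tending to \<open>0\<close>.  In a direction \<open>d\<close>
  the \<open>i\<close>-th smoothed norm has derivative \<open>(H i \<bullet> H' i d) / sqrt ((norm (H i))\<^sup>2 + \<epsilon>\<^sup>2)\<close>.  If
  \<open>H i x \<noteq> 0\<close>, this converges to the derivative of \<open>norm (H i)\<close> at \<open>x\<close>; if \<open>H i x = 0\<close>, it is at
  most \<open>norm (H' i d)\<close>, which converges to the one-sided directional derivative of \<open>norm (H i)\<close> at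
  \<open>x\<close>.  In the limit the one-sided directional derivative of the objective at \<open>x\<close> is nonnegative in
  every direction.  The Clarke directional derivative is at least as large, as the choice of the
  base point \<open>y = x\<close> shows.
\<close>

section \<open>Continuously differentiable maps\<close>

text \<open>
  \<open>f'\<close> is the derivative of \<open>f\<close> on the whole space, and it is jointly continuous in the point
  and in the direction.  In finite dimension joint continuity is the same as continuity of the
  derivative in the operator norm; the joint form is stable under composition without any
  reference to operator norms.
\<close>
definition C1_deriv ::
    "('a::real_normed_vector \<Rightarrow> 'b::real_normed_vector) \<Rightarrow> ('a \<Rightarrow> 'a \<Rightarrow> 'b) \<Rightarrow> bool" where
  "C1_deriv f f' \<longleftrightarrow>
     (\<forall>x. (f has_derivative f' x) (at x)) \<and> continuous_on UNIV (\<lambda>p. f' (fst p) (snd p))"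

text \<open>Continuous differentiability on the whole space.\<close>
definition cont_diff :: "('a::real_normed_vector \<Rightarrow> 'b::real_normed_vector) \<Rightarrow> bool" where
  "cont_diff f \<longleftrightarrow> (\<exists>f'. C1_deriv f f')"

lemma C1_derivD: "C1_deriv f f' \<Longrightarrow> (f has_derivative f' x) (at x)"
  by (simp add: C1_deriv_def)

lemma C1_deriv_bounded_linear: "C1_deriv f f' \<Longrightarrow> bounded_linear (f' x)"
  using C1_derivD has_derivative_bounded_linear by blast

lemma C1_deriv_continuous:
  assumes "C1_deriv f f'" "continuous_on S u" "continuous_on S v"
  shows "continuous_on S (\<lambda>x. f' (u x) (v x))"
proof -
  have "continuous_on UNIV (\<lambda>p. f' (fst p) (snd p))"
    using assms(1) by (simp add: C1_deriv_def)
  moreover have "continuous_on S (\<lambda>x. (u x, v x))"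
    by (intro continuous_intros assms)
  ultimately show ?thesis
    using continuous_on_compose2[of UNIV "\<lambda>p. f' (fst p) (snd p)" S "\<lambda>x. (u x, v x)"] by simp
qed

lemma C1_deriv_continuous_on: "C1_deriv f f' \<Longrightarrow> continuous_on S f"
  by (meson C1_derivD continuous_at_imp_continuous_on has_derivative_continuous)

lemma C1_deriv_continuous_compose:
  assumes "C1_deriv f f'" "continuous_on S u"
  shows "continuous_on S (\<lambda>x. f (u x))"
  using continuous_on_compose2[OF C1_deriv_continuous_on[OF assms(1), of UNIV] assms(2)] by simp

lemma C1_deriv_tendsto:
  assumes "C1_deriv f f'" "(u \<longlongrightarrow> x) F"
  shows "((\<lambda>t. f' (u t) d) \<longlongrightarrow> f' x d) F"
proof -
  have "continuous_on UNIV (\<lambda>x. f' x d)"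
    by (rule C1_deriv_continuous[OF assms(1)]) (auto intro: continuous_intros)
  then have "isCont (\<lambda>x. f' x d) x"
    by (simp add: continuous_on_eq_continuous_at)
  then show ?thesis
    using assms(2) isCont_tendsto_compose by blast
qed

lemma cont_diffI: "C1_deriv f f' \<Longrightarrow> cont_diff f"
  by (auto simp: cont_diff_def)

lemma C1_derivI:
  assumes "\<And>x. (f has_derivative f' x) (at x)"
    and "continuous_on UNIV (\<lambda>p. f' (fst p) (snd p))"
  shows "C1_deriv f f'"
  using assms by (auto simp: C1_deriv_def)

lemma cont_diff_bounded_linear:
  assumes "bounded_linear f"
  shows "cont_diff f"
proof (rule cont_diffI, rule C1_derivI)
  show "(f has_derivative f) (at x)" for x
    by (rule bounded_linear_imp_has_derivative[OF assms])
  show "continuous_on UNIV (\<lambda>p. f (snd p))"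
    by (intro bounded_linear.continuous_on[OF assms] continuous_intros)
qed

lemma cont_diff_const: "cont_diff (\<lambda>x. c)"
  by (rule cont_diffI[where f' = "\<lambda>x d. 0"], rule C1_derivI) auto

lemma cont_diff_compose:
  assumes "cont_diff g" "cont_diff f"
  shows "cont_diff (\<lambda>x. g (f x))"
proof -
  obtain g' f' where g: "C1_deriv g g'" and f: "C1_deriv f f'"
    using assms by (auto simp: cont_diff_def)
  show ?thesis
  proof (rule cont_diffI, rule C1_derivI)
    show "((\<lambda>x. g (f x)) has_derivative (\<lambda>d. g' (f x) (f' x d))) (at x)" for x
      using has_derivative_compose[OF C1_derivD[OF f] C1_derivD[OF g]] .
    show "continuous_on UNIV (\<lambda>p. g' (f (fst p)) (f' (fst p) (snd p)))"
      by (rule C1_deriv_continuous[OF g])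
        (rule C1_deriv_continuous_compose[OF f] C1_deriv_continuous[OF f]
          continuous_on_fst continuous_on_snd continuous_on_id)+
  qed
qed

lemma cont_diff_linear_compose:
  "bounded_linear g \<Longrightarrow> cont_diff f \<Longrightarrow> cont_diff (\<lambda>x. g (f x))"
  by (rule cont_diff_compose[OF cont_diff_bounded_linear])

lemma cont_diff_add:
  assumes "cont_diff f" "cont_diff g"
  shows "cont_diff (\<lambda>x. f x + g x)"
proof -
  obtain g' f' where g: "C1_deriv g g'" and f: "C1_deriv f f'"
    using assms by (auto simp: cont_diff_def)
  show ?thesis
  proof (rule cont_diffI, rule C1_derivI)
    show "((\<lambda>x. f x + g x) has_derivative (\<lambda>d. f' x d + g' x d)) (at x)" for x
      by (intro has_derivative_add C1_derivD f g)
    show "continuous_on UNIV (\<lambda>p. f' (fst p) (snd p) + g' (fst p) (snd p))"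
      by (intro continuous_on_add C1_deriv_continuous[OF g] C1_deriv_continuous[OF f]
          continuous_on_fst continuous_on_snd continuous_on_id)
  qed
qed

lemma cont_diff_diff:
  assumes "cont_diff f" "cont_diff g"
  shows "cont_diff (\<lambda>x. f x - g x)"
  using cont_diff_add[OF assms(1)
      cont_diff_linear_compose[OF bounded_linear_minus[OF bounded_linear_ident] assms(2)]]
  by simp

lemma cont_diff_sum:
  assumes "\<And>i. i \<in> I \<Longrightarrow> cont_diff (f i)"
  shows "cont_diff (\<lambda>x. \<Sum>i\<in>I. f i x)"
  using assms
  by (induction I rule: infinite_finite_induct) (auto intro: cont_diff_add cont_diff_const)

lemma C1_deriv_inner:
  assumes f: "C1_deriv f f'" and g: "C1_deriv g g'"
  shows "C1_deriv (\<lambda>x. f x \<bullet> g x) (\<lambda>x d. f x \<bullet> g' x d + f' x d \<bullet> g x)"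
proof (rule C1_derivI)
  show "((\<lambda>x. f x \<bullet> g x) has_derivative (\<lambda>d. f x \<bullet> g' x d + f' x d \<bullet> g x)) (at x)" for x
    by (intro has_derivative_inner C1_derivD f g)
  show "continuous_on UNIV (\<lambda>p. f (fst p) \<bullet> g' (fst p) (snd p) + f' (fst p) (snd p) \<bullet> g (fst p))"
    by (intro continuous_on_add continuous_on_inner C1_deriv_continuous_compose[OF f]
        C1_deriv_continuous_compose[OF g] C1_deriv_continuous[OF f] C1_deriv_continuous[OF g]
        continuous_on_fst continuous_on_snd continuous_on_id)
qed

lemma cont_diff_norm_power2:
  fixes f :: "'a::real_normed_vector \<Rightarrow> 'b::real_inner"
  shows "cont_diff f \<Longrightarrow> cont_diff (\<lambda>x. (norm (f x))\<^sup>2)"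
  unfolding cont_diff_def power2_norm_eq_inner using C1_deriv_inner by blast

lemma cont_diff_vec:
  fixes f :: "'a::real_normed_vector \<Rightarrow> 'b::euclidean_space^'n::finite"
  assumes "\<And>i. cont_diff (\<lambda>x. f x $ i)"
  shows "cont_diff f"
proof -
  have "bounded_linear (axis i :: 'b \<Rightarrow> 'b^'n)" for i
    unfolding linear_conv_bounded_linear[symmetric]
    by (rule linearI) (auto simp: axis_def vec_eq_iff)
  then have "cont_diff (\<lambda>x. \<Sum>i\<in>UNIV. axis i (f x $ i))"
    by (intro cont_diff_sum cont_diff_linear_compose[OF _ assms])
  moreover have "(\<Sum>i\<in>UNIV. axis i (f x $ i)) = f x" for x
  proof (rule vec_eq_iff[THEN iffD2], rule allI)
    fix j
    have "(\<Sum>i\<in>UNIV. axis i (f x $ i)) $ j = (\<Sum>i\<in>UNIV. if i = j then f x $ i else 0)"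
      unfolding sum_component by (intro sum.cong) (auto simp: axis_def)
    then show "(\<Sum>i\<in>UNIV. axis i (f x $ i)) $ j = f x $ j"
      by simp
  qed
  ultimately show ?thesis
    by simp
qed

lemma cont_diff_vec_nth: "cont_diff f \<Longrightarrow> cont_diff (\<lambda>x. f x $ i)"
  by (rule cont_diff_linear_compose[OF bounded_linear_vec_nth])

lemma cont_diff_mult_left:
  fixes f :: "'a::real_normed_vector \<Rightarrow> 'b::real_normed_algebra"
  shows "cont_diff f \<Longrightarrow> cont_diff (\<lambda>x. c * f x)"
  by (rule cont_diff_linear_compose[OF bounded_linear_mult_right])

lemma cont_diff_mult_right:
  fixes f :: "'a::real_normed_vector \<Rightarrow> 'b::real_normed_algebra"
  shows "cont_diff f \<Longrightarrow> cont_diff (\<lambda>x. f x * c)"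
  by (rule cont_diff_linear_compose[OF bounded_linear_mult_left])

lemma cont_diff_matrix_vector_mult:
  fixes A :: "complex^'n::finite^'k::finite"
  assumes "cont_diff f"
  shows "cont_diff (\<lambda>x. A *v f x)"
  by (rule cont_diff_vec)
    (auto simp: matrix_vector_mult_def intro!: cont_diff_sum cont_diff_mult_left cont_diff_vec_nth assms)

lemma has_derivative_one_sided_quotient:
  fixes f :: "'a::real_normed_vector \<Rightarrow> 'b::real_normed_vector"
  assumes "(f has_derivative f') (at x)"
  shows "((\<lambda>s. (f (x + s *\<^sub>R d) - f x) /\<^sub>R s) \<longlongrightarrow> f' d) (at_right 0)"
proof -
  have "((\<lambda>s. f (x + s *\<^sub>R d)) has_derivative (\<lambda>s. f' (s *\<^sub>R d))) (at 0)"
    by (rule has_derivative_compose[where g = f and f = "\<lambda>s. x + s *\<^sub>R d"])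
      (auto intro!: derivative_eq_intros assms)
  then have "((\<lambda>s. f (x + s *\<^sub>R d)) has_vector_derivative f' d) (at 0)"
    using bounded_linear.linear[OF has_derivative_bounded_linear[OF assms]]
    by (simp add: has_vector_derivative_def linear_cmul)
  then have "((\<lambda>s. norm (f (x + s *\<^sub>R d) - f x - s *\<^sub>R f' d) / norm s) \<longlongrightarrow> 0) (at 0)"
    by (simp add: has_vector_derivative_def has_derivative_at)
  moreover have "norm (f (x + s *\<^sub>R d) - f x - s *\<^sub>R f' d) / norm s
      = norm ((f (x + s *\<^sub>R d) - f x) /\<^sub>R s - f' d)" if "s \<noteq> 0" for s
  proof -
    have "(f (x + s *\<^sub>R d) - f x) /\<^sub>R s - f' d = (f (x + s *\<^sub>R d) - f x - s *\<^sub>R f' d) /\<^sub>R s"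
      using that by (simp add: scaleR_diff_right)
    then show ?thesis
      by (simp add: divide_inverse_commute)
  qed
  ultimately have "((\<lambda>s. norm ((f (x + s *\<^sub>R d) - f x) /\<^sub>R s - f' d)) \<longlongrightarrow> 0) (at 0)"
    by (auto elim!: Lim_transform_eventually simp: eventually_at_filter)
  then have "((\<lambda>s. (f (x + s *\<^sub>R d) - f x) /\<^sub>R s) \<longlongrightarrow> f' d) (at 0)"
    using LIM_zero_iff tendsto_norm_zero_iff by blast
  then show ?thesis
    by (rule filterlim_mono) (auto simp: at_le)
qed

section \<open>Smoothness of the networks\<close>

text \<open>
  The truncated square \<open>(max 0 x)\<^sup>2\<close> is the building block of the activation: \<open>srelu\<close> is a
  combination of two of its translates, so that no gluing of derivatives at \<open>\<plusminus>\<delta>\<close> is needed.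
\<close>
lemma cont_diff_max_power2: "cont_diff (\<lambda>x::real. (max 0 x)\<^sup>2)"
proof (rule cont_diffI, rule C1_derivI)
  fix x :: real
  have bound: "\<bar>(max 0 (x + h))\<^sup>2 - (max 0 x)\<^sup>2 - 2 * max 0 x * h\<bar> \<le> h\<^sup>2" for h :: real
  proof -
    consider "0 \<le> x" "0 \<le> x + h" | "0 \<le> x" "x + h < 0" | "x < 0" "0 \<le> x + h" | "x < 0" "x + h < 0"
      by linarith
    then show ?thesis
    proof cases
      case 1
      then show ?thesis by (simp add: max_def power2_eq_square algebra_simps)
    next
      case 2
      have "0 \<le> (x + h)\<^sup>2"
        by simp
      moreover have "x * (x + 2 * h) \<le> 0" using 2 by (intro mult_nonneg_nonpos) auto
      ultimately show ?thesis
        using 2 by (simp add: max_def power2_eq_square algebra_simps)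
    next
      case 3
      then have "(x + h)\<^sup>2 \<le> h\<^sup>2" by (intro power_mono) auto
      then show ?thesis using 3 by (simp add: max_def)
    qed (simp add: max_def)
  qed
  have "((\<lambda>h. ((max 0 (x + h))\<^sup>2 - (max 0 x)\<^sup>2) / h - 2 * max 0 x) \<longlongrightarrow> 0) (at 0)"
  proof (rule Lim_null_comparison)
    show "((\<lambda>h::real. \<bar>h\<bar>) \<longlongrightarrow> 0) (at 0)"
      by (rule tendsto_eq_intros) auto
    have "norm (((max 0 (x + h))\<^sup>2 - (max 0 x)\<^sup>2) / h - 2 * max 0 x) \<le> \<bar>h\<bar>" if "h \<noteq> 0" for h
    proof -
      have "norm (((max 0 (x + h))\<^sup>2 - (max 0 x)\<^sup>2) / h - 2 * max 0 x)
          = \<bar>(max 0 (x + h))\<^sup>2 - (max 0 x)\<^sup>2 - 2 * max 0 x * h\<bar> / \<bar>h\<bar>"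
        using that by (simp add: diff_divide_distrib abs_divide[symmetric] del: abs_divide)
      also have "\<dots> \<le> h\<^sup>2 / \<bar>h\<bar>"
        by (intro divide_right_mono bound) simp
      also have "\<dots> = \<bar>h\<bar>"
        using that by (simp add: power2_eq_square divide_simps)
      finally show ?thesis .
    qed
    then show "\<forall>\<^sub>F h in at 0. norm (((max 0 (x + h))\<^sup>2 - (max 0 x)\<^sup>2) / h - 2 * max 0 x) \<le> \<bar>h\<bar>"
      by (simp add: eventually_at_filter)
  qed
  then have "((\<lambda>x::real. (max 0 x)\<^sup>2) has_field_derivative 2 * max 0 x) (at x)"
    by (simp add: DERIV_def LIM_zero_iff)
  then show "((\<lambda>x::real. (max 0 x)\<^sup>2) has_derivative (\<lambda>d. 2 * max 0 x * d)) (at x)"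
    by (simp add: has_field_derivative_def)
  show "continuous_on UNIV (\<lambda>p::real \<times> real. 2 * max 0 (fst p) * snd p)"
    by (intro continuous_intros)
qed

lemma srelu_eq_max_power2:
  assumes "\<delta> > 0"
  shows "srelu \<delta> x = ((max 0 (x + \<delta>))\<^sup>2 - (max 0 (x - \<delta>))\<^sup>2) * (1 / (4 * \<delta>))"
proof -
  consider "x \<le> - \<delta>" | "- \<delta> < x" "x < \<delta>" | "\<delta> \<le> x"
    by linarith
  then show ?thesis
  proof cases
    case 1
    then have "max 0 (x + \<delta>) = 0" "max 0 (x - \<delta>) = 0" using assms by auto
    then show ?thesis using 1 by (simp add: srelu_def)
  next
    case 2
    then show ?thesis using assms
      by (simp add: srelu_def max_def field_simps power2_eq_square)
  next
    case 3
    then show ?thesis using assms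
      by (simp add: srelu_def max_def field_simps power2_eq_square)
  qed
qed

lemma cont_diff_srelu:
  assumes "\<delta> > 0"
  shows "cont_diff (srelu \<delta>)"
proof -
  have "cont_diff (\<lambda>x. ((max 0 (x + \<delta>))\<^sup>2 - (max 0 (x - \<delta>))\<^sup>2) * (1 / (4 * \<delta>)))"
    by (intro cont_diff_mult_right cont_diff_diff cont_diff_add cont_diff_const
        cont_diff_compose[OF cont_diff_max_power2] cont_diff_bounded_linear bounded_linear_ident)
  then show ?thesis
    unfolding srelu_eq_max_power2[OF assms, symmetric] .
qed

lemma cont_diff_csrelu:
  assumes "\<delta> > 0" "cont_diff f"
  shows "cont_diff (\<lambda>x. csrelu \<delta> (f x))"
proof -
  have "cont_diff (\<lambda>x. of_real (srelu \<delta> (Re (f x))) + \<i> * of_real (srelu \<delta> (Im (f x))))"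
    by (intro cont_diff_add cont_diff_mult_left cont_diff_linear_compose[OF bounded_linear_of_real]
        cont_diff_compose[OF cont_diff_srelu[OF assms(1)]] assms(2)
        cont_diff_linear_compose[OF bounded_linear_Re] cont_diff_linear_compose[OF bounded_linear_Im])
  then show ?thesis
    by (simp add: csrelu_def complex_eq[symmetric] Complex_eq)
qed

lemma cont_diff_convolve:
  assumes "\<And>p i. cont_diff (\<lambda>x. u x p i)"
  shows "cont_diff (\<lambda>x. convolve c (u x) q b)"
  unfolding convolve_def
proof (rule cont_diff_sum)
  fix k
  show "cont_diff (\<lambda>x. case tap c q k of None \<Rightarrow> 0
                     | Some p \<Rightarrow> \<Sum>i<in_chan c. weight c b i k * u x p i)"
    by (cases "tap c q k")
      (auto intro!: cont_diff_const cont_diff_sum cont_diff_mult_left assms)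
qed

text \<open>
  Feature maps with unspecified numbers of positions and channels do not form a normed space,
  so smoothness of the layers is stated entry by entry.
\<close>
lemma cont_diff_layers:
  assumes "\<delta> > 0" "\<And>p i. cont_diff (\<lambda>x. u x p i)"
  shows "cont_diff (\<lambda>x. layers \<delta> ws (u x) q b)"
  using assms(2)
proof (induction ws arbitrary: u rule: induct_list012)
  case (3 w w' ws)
  show ?case
    unfolding layers.simps
    by (rule "3.IH"(2)) (intro cont_diff_csrelu assms(1) cont_diff_convolve "3.prems")
qed (auto intro: cont_diff_convolve)

lemma cont_diff_conv_net:
  fixes u :: "'a::real_normed_vector \<Rightarrow> complex^'c::finite^'p::finite"
  assumes "\<delta> > 0" "cont_diff u"
  shows "cont_diff (\<lambda>x. conv_net \<delta> ws (u x))"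
proof -
  have "cont_diff (\<lambda>x. to_fmap (u x) p i)" for p i
    by (cases "p < CARD('p) \<and> i < CARD('c)")
      (auto simp: to_fmap_def intro!: cont_diff_vec_nth cont_diff_const assms(2))
  then show ?thesis
    unfolding conv_net_def
    by (intro cont_diff_vec) (auto intro: cont_diff_layers assms(1))
qed

lemma cont_diff_feature_net:
  assumes "\<delta> > 0" "is_feature_net \<delta> ws h" "cont_diff f"
  shows "cont_diff (\<lambda>x. h (f x))"
proof -
  have "cont_diff (\<lambda>x. (\<chi> i _. f x $ i) :: complex^1^_)"
    by (intro cont_diff_vec) (auto intro: cont_diff_vec_nth assms(3))
  then show ?thesis
    using assms by (auto simp: is_feature_net_def feature_net_def intro: cont_diff_conv_net)
qed

lemma cont_diff_synthesis_net:
  assumes "\<delta> > 0" "is_synthesis_net \<delta> ws g" "cont_diff f"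
  shows "cont_diff (\<lambda>x. g (f x))"
proof -
  have "g = synthesis_net \<delta> ws"
    using assms(2) by (simp add: is_synthesis_net_def)
  then show ?thesis
    unfolding synthesis_net_def
    by (simp, intro cont_diff_vec, unfold vec_lambda_beta)
      (intro cont_diff_vec_nth cont_diff_conv_net assms)
qed

lemma cont_diff_concat_channels:
  assumes "cont_diff f" "cont_diff g"
  shows "cont_diff (\<lambda>x. concat_channels (f x) (g x))"
proof (intro cont_diff_vec)
  fix j c
  show "cont_diff (\<lambda>x. concat_channels (f x) (g x) $ j $ c)"
    by (cases c) (auto simp: concat_channels_def intro!: cont_diff_vec_nth assms)
qed

lemma cont_diff_dft:
  assumes "cont_diff f"
  shows "cont_diff (\<lambda>x. dft N\<^sub>1 N\<^sub>2 pix (f x))"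
  unfolding dft_def
  by (rule cont_diff_vec, unfold vec_lambda_beta)
    (intro cont_diff_sum cont_diff_mult_left cont_diff_vec_nth assms)


section \<open>Gradients and the line search\<close>

lemma C1_deriv_grad:
  fixes f :: "'a::euclidean_space \<Rightarrow> real"
  assumes "C1_deriv f f'"
  shows "grad f x = (\<Sum>b\<in>Basis. f' x b *\<^sub>R b)"
    and "f' x d = d \<bullet> grad f x"
proof -
  let ?v = "\<Sum>b\<in>Basis. f' x b *\<^sub>R b"
  have lin: "linear (f' x)"
    using C1_deriv_bounded_linear[OF assms] bounded_linear.linear by blast
  have eq: "f' x d = d \<bullet> ?v" for d
  proof -
    have "f' x d = f' x (\<Sum>b\<in>Basis. (d \<bullet> b) *\<^sub>R b)"
      by (simp add: euclidean_representation)
    also have "\<dots> = (\<Sum>b\<in>Basis. (d \<bullet> b) *\<^sub>R f' x b)"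
      by (simp add: linear_sum[OF lin] linear_cmul[OF lin])
    also have "\<dots> = d \<bullet> ?v"
      by (simp add: inner_sum_right mult.commute)
    finally show ?thesis .
  qed
  have v: "GDERIV f x :> ?v"
    using C1_derivD[OF assms, of x] by (simp add: gderiv_def eq[symmetric, abs_def])
  have uniq: "w = ?v" if "GDERIV f x :> w" for w
  proof -
    have "(\<lambda>h. h \<bullet> w) = (\<lambda>h. h \<bullet> ?v)"
      using that v unfolding gderiv_def by (rule has_derivative_unique)
    then have "\<forall>h. h \<bullet> w = h \<bullet> ?v"
      by (simp only: fun_eq_iff simp_thms)
    then show ?thesis
      by (simp only: vector_eq_ldot)
  qed
  show *: "grad f x = ?v"
    unfolding grad_def using v uniq by (rule the_equality)
  show "f' x d = d \<bullet> grad f x"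
    unfolding * by (rule eq)
qed

lemma cont_diff_has_gradient:
  fixes f :: "'a::euclidean_space \<Rightarrow> real"
  assumes "cont_diff f"
  shows "GDERIV f x :> grad f x"
proof -
  obtain f' where f: "C1_deriv f f'"
    using assms by (auto simp: cont_diff_def)
  show ?thesis
    using C1_derivD[OF f, of x] by (simp only: gderiv_def C1_deriv_grad(2)[OF f, abs_def])
qed

lemma cont_diff_continuous_grad:
  fixes f :: "'a::euclidean_space \<Rightarrow> real"
  assumes "cont_diff f"
  shows "continuous_on S (grad f)"
proof -
  obtain f' where f: "C1_deriv f f'"
    using assms by (auto simp: cont_diff_def)
  have "continuous_on S (\<lambda>x. \<Sum>b\<in>Basis. f' x b *\<^sub>R b)"
    by (intro continuous_on_sum continuous_on_scaleR C1_deriv_continuous[OF f]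
        continuous_on_const continuous_on_id)
  then show ?thesis
    by (simp add: C1_deriv_grad(1)[OF f, abs_def])
qed

text \<open>
  On a bounded set where the gradient is bounded away from \<open>0\<close>, all sufficiently short gradient
  steps are accepted.  The proof uses the uniform continuity of the gradient on compact sets
  and no Lipschitz condition.
\<close>
lemma short_steps_accepted:
  fixes f :: "'a::euclidean_space \<Rightarrow> real"
  assumes f: "cont_diff f" and "a > 0" "c > 0"
  obtains \<beta>\<^sub>0 where "\<beta>\<^sub>0 > 0"
    "\<And>x \<beta>. norm x \<le> R \<Longrightarrow> c \<le> norm (grad f x) \<Longrightarrow> 0 < \<beta> \<Longrightarrow> \<beta> \<le> \<beta>\<^sub>0 \<Longrightarrow>
       sufficient_decrease f a x (x - \<beta> *\<^sub>R grad f x)"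
proof -
  let ?K = "cball 0 (R + 1) :: 'a set"
  have cont: "continuous_on ?K (grad f)"
    by (rule cont_diff_continuous_grad[OF f])
  have "bounded (grad f ` ?K)"
    by (intro compact_imp_bounded compact_continuous_image cont) simp
  then obtain G where G: "G > 0" "\<And>x. x \<in> ?K \<Longrightarrow> norm (grad f x) \<le> G"
    by (auto simp: bounded_pos)
  have "uniformly_continuous_on ?K (grad f)"
    by (intro compact_uniformly_continuous cont) simp
  then obtain r where r: "r > 0"
    "\<And>x y. x \<in> ?K \<Longrightarrow> y \<in> ?K \<Longrightarrow> dist y x < r \<Longrightarrow> dist (grad f y) (grad f x) < c / 2"
    using \<open>c > 0\<close> unfolding uniformly_continuous_on_def by (metis half_gt_zero)
  \<comment> \<open>Steps of this length stay in \<open>?K\<close> and move the gradient by less than \<open>c / 2\<close>; the bound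
    \<open>a / 2\<close> turns a decrease by \<open>\<beta> * (norm (grad f x))\<^sup>2 / 2\<close> into sufficient decrease.\<close>
  define \<beta>\<^sub>0 where "\<beta>\<^sub>0 = min (a / 2) (min 1 (r / 2) / G)"
  show thesis
  proof
    show "\<beta>\<^sub>0 > 0"
      using \<open>a > 0\<close> r G by (simp add: \<beta>\<^sub>0_def)
    fix x \<beta>
    assume x: "norm x \<le> R" "c \<le> norm (grad f x)" and \<beta>: "0 < \<beta>" "\<beta> \<le> \<beta>\<^sub>0"
    let ?g = "grad f x"
    have "\<beta> * G \<le> min 1 (r / 2)"
      using \<beta> G by (simp add: \<beta>\<^sub>0_def field_simps)
    moreover have "\<beta> * norm ?g \<le> \<beta> * G"
      using \<beta> G(2)[of x] x by (intro mult_left_mono) auto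
    ultimately have step: "\<beta> * norm ?g \<le> 1" "\<beta> * norm ?g < r"
      using r(1) by auto
    let ?y = "\<lambda>s. x - (s * \<beta>) *\<^sub>R ?g"
    have der: "((\<lambda>s. f (?y s)) has_real_derivative - (\<beta> * (?g \<bullet> grad f (?y s)))) (at s)" for s
    proof -
      have "(f has_derivative (\<lambda>h. h \<bullet> grad f (?y s))) (at (?y s))"
        using cont_diff_has_gradient[OF f] by (simp add: gderiv_def)
      moreover have "(?y has_derivative (\<lambda>h. - ((h * \<beta>) *\<^sub>R ?g))) (at s)"
        by (auto intro!: derivative_eq_intros)
      ultimately have "((\<lambda>s. f (?y s)) has_derivative (\<lambda>h. - ((h * \<beta>) *\<^sub>R ?g) \<bullet> grad f (?y s))) (at s)"
        by (rule has_derivative_compose[rotated])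
      moreover have "(\<lambda>h. - ((h * \<beta>) *\<^sub>R ?g) \<bullet> grad f (?y s))
          = (*) (- (\<beta> * (?g \<bullet> grad f (?y s))))"
        by (simp add: fun_eq_iff)
      ultimately show ?thesis
        by (simp only: has_field_derivative_def)
    qed
    obtain s where s: "0 < s" "s < 1"
      "f (?y 1) - f (?y 0) = (1 - 0) * - (\<beta> * (?g \<bullet> grad f (?y s)))"
      using MVT2[of 0 1 "\<lambda>s. f (?y s)", OF _ der] by auto
    have "norm (?y s - x) = s * (\<beta> * norm ?g)"
      using s \<beta> by (simp add: norm_minus_commute abs_mult)
    then have ys: "norm (?y s - x) \<le> \<beta> * norm ?g"
      using s \<beta> by (simp add: mult_left_le_one_le)
    have "norm (?y s) \<le> norm x + norm (?y s - x)"
      by (metis add.commute diff_add_cancel norm_triangle_ineq)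
    then have "?y s \<in> ?K"
      using ys step x by simp
    moreover have "dist (?y s) x < r"
      using ys step by (simp add: dist_norm)
    ultimately have close: "norm (grad f (?y s) - ?g) < c / 2"
      using r(2)[of x "?y s"] x by (simp add: dist_norm)
    have "(norm ?g)\<^sup>2 / 2 \<le> ?g \<bullet> grad f (?y s)"
    proof -
      have "\<bar>?g \<bullet> (grad f (?y s) - ?g)\<bar> \<le> norm ?g * norm (grad f (?y s) - ?g)"
        by (rule Cauchy_Schwarz_ineq2)
      also have "\<dots> \<le> norm ?g * (norm ?g / 2)"
        using close x by (intro mult_left_mono) auto
      finally have "- (norm ?g * (norm ?g / 2)) \<le> ?g \<bullet> (grad f (?y s) - ?g)"
        by linarith
      then show ?thesis
        by (simp add: inner_diff_right power2_norm_eq_inner[symmetric] power2_eq_square)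
    qed
    then have "\<beta> * ((norm ?g)\<^sup>2 / 2) \<le> \<beta> * (?g \<bullet> grad f (?y s))"
      using \<beta> by (intro mult_left_mono) auto
    moreover have "1 / a * (\<beta> * norm ?g)\<^sup>2 \<le> \<beta> * ((norm ?g)\<^sup>2 / 2)"
    proof -
      have "\<beta> / a \<le> 1 / 2"
        using \<beta> \<open>a > 0\<close> by (simp add: \<beta>\<^sub>0_def field_simps)
      then have "\<beta> / a * (\<beta> * (norm ?g)\<^sup>2) \<le> 1 / 2 * (\<beta> * (norm ?g)\<^sup>2)"
        using \<beta> by (intro mult_right_mono) auto
      then show ?thesis
        by (simp add: power2_eq_square mult_ac)
    qed
    ultimately have "1 / a * (\<beta> * norm ?g)\<^sup>2 \<le> \<beta> * (?g \<bullet> grad f (?y s))"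
      by (rule order_trans[rotated])
    then show "sufficient_decrease f a x (x - \<beta> *\<^sub>R ?g)"
      using s(3) \<beta> by (simp add: sufficient_decrease_def)
  qed
qed

text \<open>
  If all steps up to length \<open>\<beta>\<^sub>0\<close> are acceptable, then backtracking stops at a step of length at
  least \<open>min \<alpha> (\<rho> * \<beta>\<^sub>0)\<close>, however large the initial trial step \<open>\<alpha>\<close> is.
\<close>
lemma line_search_step:
  assumes ls: "line_search f \<rho> a \<alpha> x x'" and "0 < \<rho>" "\<rho> < 1" "\<alpha> > 0"
    and acc: "\<And>\<beta>. 0 < \<beta> \<Longrightarrow> \<beta> \<le> \<beta>\<^sub>0 \<Longrightarrow> sufficient_decrease f a x (x - \<beta> *\<^sub>R grad f x)"
  obtains \<beta> where "min \<alpha> (\<rho> * \<beta>\<^sub>0) \<le> \<beta>" "x' = x - \<beta> *\<^sub>R grad f x" "sufficient_decrease f a x x'"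
proof -
  obtain k where k: "x' = x - (\<rho> ^ k * \<alpha>) *\<^sub>R grad f x" "sufficient_decrease f a x x'"
    "\<And>i. i < k \<Longrightarrow> \<not> sufficient_decrease f a x (x - (\<rho> ^ i * \<alpha>) *\<^sub>R grad f x)"
    using ls by (auto simp: line_search_def)
  have "min \<alpha> (\<rho> * \<beta>\<^sub>0) \<le> \<rho> ^ k * \<alpha>"
  proof (cases k)
    case (Suc j)
    \<comment> \<open>The last rejected trial step is longer than \<open>\<beta>\<^sub>0\<close>.\<close>
    have "0 < \<rho> ^ j * \<alpha>"
      using assms by simp
    then have "\<beta>\<^sub>0 < \<rho> ^ j * \<alpha>"
      using k(3)[of j] acc[of "\<rho> ^ j * \<alpha>"] Suc by fastforce
    then have "\<rho> * \<beta>\<^sub>0 \<le> \<rho> * (\<rho> ^ j * \<alpha>)"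
      using \<open>0 < \<rho>\<close> by simp
    then show ?thesis
      using Suc by (simp add: mult_ac)
  qed simp
  then show thesis
    using that k by blast
qed

section \<open>Clarke directional derivatives\<close>

text \<open>The upper limit over base points \<open>y\<close> near \<open>x\<close> includes the base point \<open>y = x\<close>.\<close>
lemma clarke_dir_deriv_ge:
  assumes "((\<lambda>s. (f (x + s *\<^sub>R d) - f x) / s) \<longlongrightarrow> D) (at_right 0)"
  shows "ereal D \<le> clarke_dir_deriv f x d"
proof -
  let ?q = "\<lambda>(y, s). ereal ((f (y + s *\<^sub>R d) - f y) / s)"
  have inj: "inj (\<lambda>s::real. (x, s))"
    by (auto simp: inj_on_def)
  have "filterlim (\<lambda>s. (x, s)) (nhds x \<times>\<^sub>F at_right 0) (at_right (0::real))"
    by (intro filterlim_Pair filterlim_ident tendsto_const)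
  then have le: "filtermap (\<lambda>s. (x, s)) (at_right (0::real)) \<le> nhds x \<times>\<^sub>F at_right 0"
    by (simp add: filterlim_def)
  have "((\<lambda>s. ?q (x, s)) \<longlongrightarrow> ereal D) (at_right 0)"
    using assms by simp
  then have "Limsup (at_right 0) (\<lambda>s. ?q (x, s)) = ereal D"
    by (intro lim_imp_Limsup) auto
  then have "ereal D = Limsup (filtermap (\<lambda>s. (x, s)) (at_right (0::real))) ?q"
    using Limsup_filtermap_eq[OF inj, of "at_right 0" ?q] by simp
  also have "\<dots> \<le> Limsup (nhds x \<times>\<^sub>F at_right 0) ?q"
    unfolding Limsup_def using le by (intro INF_superset_mono) (auto simp: le_filter_def)
  finally show ?thesis
    by (simp add: clarke_dir_deriv_def)
qed

section \<open>Smoothing a composite objective\<close>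

text \<open>
  A smooth function plus finitely many norms of smooth maps; \<open>\<phi>'\<close> and \<open>H'\<close> are the derivatives.
\<close>
locale norm_composite =
  fixes \<phi> :: "'a::euclidean_space \<Rightarrow> real" and \<phi>' :: "'a \<Rightarrow> 'a \<Rightarrow> real"
    and H :: "'i \<Rightarrow> 'a \<Rightarrow> 'b::real_inner" and H' :: "'i \<Rightarrow> 'a \<Rightarrow> 'a \<Rightarrow> 'b"
    and I :: "'i set"
  assumes finite_I: "finite I"
    and \<phi>: "C1_deriv \<phi> \<phi>'"
    and H: "\<And>i. i \<in> I \<Longrightarrow> C1_deriv (H i) (H' i)"
begin

text \<open>The nonsmooth objective.\<close>
definition obj :: "'a \<Rightarrow> real" where
  "obj x = \<phi> x + (\<Sum>i\<in>I. norm (H i x))"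

text \<open>The objective smoothed with parameter \<open>e\<close>.\<close>
definition smooth :: "real \<Rightarrow> 'a \<Rightarrow> real" where
  "smooth e x = \<phi> x + (\<Sum>i\<in>I. sqrt ((norm (H i x))\<^sup>2 + e\<^sup>2) - e)"

text \<open>The derivative of \<open>smooth e\<close> for \<open>e > 0\<close>, at \<open>x\<close> in direction \<open>d\<close>.\<close>
definition smooth' :: "real \<Rightarrow> 'a \<Rightarrow> 'a \<Rightarrow> real" where
  "smooth' e x d = \<phi>' x d + (\<Sum>i\<in>I. (H i x \<bullet> H' i x d) / sqrt ((norm (H i x))\<^sup>2 + e\<^sup>2))"

lemma C1_deriv_smooth:
  assumes "e > 0"
  shows "C1_deriv (smooth e) (smooth' e)"
proof (rule C1_derivI)
  have pos: "0 < (norm (H i x))\<^sup>2 + e\<^sup>2" for i x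
    using assms by (simp add: add_nonneg_pos)
  have "((\<lambda>x. sqrt ((norm (H i x))\<^sup>2 + e\<^sup>2) - e) has_derivative
      (\<lambda>d. (H i x \<bullet> H' i x d) / sqrt ((norm (H i x))\<^sup>2 + e\<^sup>2))) (at x)" if "i \<in> I" for i x
  proof -
    have "((\<lambda>x. H i x \<bullet> H i x + e\<^sup>2) has_derivative (\<lambda>d. 2 * (H i x \<bullet> H' i x d))) (at x)"
      by (auto intro!: derivative_eq_intros C1_derivD[OF H[OF that]] simp: inner_commute)
    from has_derivative_real_sqrt[OF _ this]
    have "((\<lambda>x. sqrt (H i x \<bullet> H i x + e\<^sup>2)) has_derivative
        (\<lambda>d. 2 * (H i x \<bullet> H' i x d) * (inverse (sqrt (H i x \<bullet> H i x + e\<^sup>2)) / 2))) (at x)"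
      using pos[of i x] by (simp add: power2_norm_eq_inner)
    from has_derivative_diff[OF this has_derivative_const[of e]] show ?thesis
      unfolding power2_norm_eq_inner divide_inverse by (simp only: diff_zero mult.assoc) simp
  qed
  then show "(smooth e has_derivative smooth' e x) (at x)" for x
    unfolding smooth_def[abs_def] smooth'_def[abs_def]
    by (intro has_derivative_add has_derivative_sum C1_derivD[OF \<phi>])
  show "continuous_on UNIV (\<lambda>p. smooth' e (fst p) (snd p))"
    unfolding smooth'_def
  proof (intro continuous_on_add continuous_on_sum)
    show "continuous_on UNIV (\<lambda>p. \<phi>' (fst p) (snd p))"
      using \<phi> by (simp add: C1_deriv_def)
    fix i assume i: "i \<in> I"
    have "continuous_on UNIV (\<lambda>p::'a \<times> 'a. H i (fst p))"
      by (rule C1_deriv_continuous_compose[OF H[OF i] continuous_on_fst[OF continuous_on_id]])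
    moreover have "continuous_on UNIV (\<lambda>p. H' i (fst p) (snd p))"
      using H[OF i] by (simp add: C1_deriv_def)
    moreover have "sqrt ((norm (H i x))\<^sup>2 + e\<^sup>2) \<noteq> 0" for x
      using pos[of i x] by (metis less_irrefl real_sqrt_eq_zero_cancel_iff)
    ultimately show "continuous_on UNIV
        (\<lambda>p. (H i (fst p) \<bullet> H' i (fst p) (snd p)) / sqrt ((norm (H i (fst p)))\<^sup>2 + e\<^sup>2))"
      by (intro continuous_intros) auto
  qed
qed

lemma obj_le_smooth: "obj x \<le> smooth e x + real (card I) * e"
proof -
  have "(\<Sum>i\<in>I. norm (H i x)) \<le> (\<Sum>i\<in>I. sqrt ((norm (H i x))\<^sup>2 + e\<^sup>2))"
    by (intro sum_mono) (simp add: real_le_rsqrt)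
  then show ?thesis
    by (simp add: obj_def smooth_def sum_subtractf)
qed

lemma smooth_shifted_mono:
  assumes "0 \<le> e'" "e' \<le> e"
  shows "smooth e' x + real (card I) * e' \<le> smooth e x + real (card I) * e"
proof -
  have "(\<Sum>i\<in>I. sqrt ((norm (H i x))\<^sup>2 + e'\<^sup>2)) \<le> (\<Sum>i\<in>I. sqrt ((norm (H i x))\<^sup>2 + e\<^sup>2))"
    using assms by (intro sum_mono) (simp add: power_mono)
  then show ?thesis
    by (simp add: smooth_def sum_subtractf)
qed

lemma obj_one_sided_derivative:
  "((\<lambda>s. (obj (x + s *\<^sub>R d) - obj x) / s) \<longlongrightarrow>
     \<phi>' x d + (\<Sum>i\<in>I. if H i x = 0 then norm (H' i x d) else (H i x \<bullet> H' i x d) / norm (H i x)))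
   (at_right 0)"
proof -
  have "((\<lambda>s. (\<phi> (x + s *\<^sub>R d) - \<phi> x) / s) \<longlongrightarrow> \<phi>' x d) (at_right 0)"
    using has_derivative_one_sided_quotient[OF C1_derivD[OF \<phi>], where x = x and d = d]
    by (simp add: divide_inverse_commute)
  moreover have "((\<lambda>s. (norm (H i (x + s *\<^sub>R d)) - norm (H i x)) / s) \<longlongrightarrow>
      (if H i x = 0 then norm (H' i x d) else (H i x \<bullet> H' i x d) / norm (H i x))) (at_right 0)"
    if "i \<in> I" for i
  proof (cases "H i x = 0")
    case True
    have "((\<lambda>s. norm ((H i (x + s *\<^sub>R d) - H i x) /\<^sub>R s)) \<longlongrightarrow> norm (H' i x d)) (at_right 0)"
      by (intro tendsto_norm has_derivative_one_sided_quotient C1_derivD H that)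
    then have "((\<lambda>s. norm (H i (x + s *\<^sub>R d)) / s) \<longlongrightarrow> norm (H' i x d)) (at_right 0)"
      by (rule Lim_transform_eventually)
        (auto simp: eventually_at_filter True divide_inverse_commute)
    then show ?thesis
      using True by simp
  next
    case False
    have "((\<lambda>x. norm (H i x)) has_derivative (\<lambda>d. H' i x d \<bullet> sgn (H i x))) (at x)"
      by (rule has_derivative_compose[OF C1_derivD[OF H[OF that]] has_derivative_norm[OF False]])
    from has_derivative_one_sided_quotient[OF this, where d = d] show ?thesis
      using False by (simp add: divide_inverse_commute sgn_div_norm inner_commute)
  qed
  ultimately have "((\<lambda>s. (\<phi> (x + s *\<^sub>R d) - \<phi> x) / s
      + (\<Sum>i\<in>I. (norm (H i (x + s *\<^sub>R d)) - norm (H i x)) / s)) \<longlongrightarrow>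
     \<phi>' x d + (\<Sum>i\<in>I. if H i x = 0 then norm (H' i x d) else (H i x \<bullet> H' i x d) / norm (H i x)))
   (at_right 0)"
    by (intro tendsto_add tendsto_sum)
  moreover have "(\<phi> (x + s *\<^sub>R d) - \<phi> x) / s + (\<Sum>i\<in>I. (norm (H i (x + s *\<^sub>R d)) - norm (H i x)) / s)
      = (obj (x + s *\<^sub>R d) - obj x) / s" for s
    by (simp add: obj_def sum_subtractf diff_divide_distrib add_divide_distrib sum_divide_distrib)
  ultimately show ?thesis
    by simp
qed

text \<open>
  The vectors \<open>H i (Y k) / sqrt ((norm (H i (Y k)))\<^sup>2 + (e k)\<^sup>2)\<close> need not converge where
  \<open>H i x = 0\<close>, but their norm is at most \<open>1\<close>; the Cauchy-Schwarz inequality is all that is used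
  there, so that no convergent subsequence has to be chosen.
\<close>
lemma smoothing_limit_stationary:
  fixes e :: "nat \<Rightarrow> real"
  assumes e: "e \<longlonglongrightarrow> 0" "\<And>k. e k > 0" and Y: "Y \<longlonglongrightarrow> x"
    and g: "(\<lambda>k. norm (grad (smooth (e k)) (Y k))) \<longlonglongrightarrow> 0"
  shows "clarke_stationary obj x"
  unfolding clarke_stationary_def clarke_subdifferential_def
proof (clarify)
  fix d
  \<comment> \<open>An upper bound for the \<open>i\<close>-th summand of \<open>smooth' (e k) (Y k) d\<close>.\<close>
  define B where "B i k = (if H i x = 0 then norm (H' i (Y k) d)
    else (H i (Y k) \<bullet> H' i (Y k) d) / sqrt ((norm (H i (Y k)))\<^sup>2 + (e k)\<^sup>2))" for i k
  let ?D = "\<phi>' x d + (\<Sum>i\<in>I. if H i x = 0 then norm (H' i x d) else (H i x \<bullet> H' i x d) / norm (H i x))"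
  have "(\<lambda>k. \<phi>' (Y k) d + (\<Sum>i\<in>I. B i k)) \<longlonglongrightarrow> ?D"
  proof (intro tendsto_add tendsto_sum C1_deriv_tendsto[OF \<phi>] Y)
    fix i assume i: "i \<in> I"
    have H'lim: "(\<lambda>k. H' i (Y k) d) \<longlonglongrightarrow> H' i x d"
      by (rule C1_deriv_tendsto[OF H[OF i] Y])
    have "isCont (H i) x"
      using C1_derivD[OF H[OF i]] has_derivative_continuous by blast
    then have Hlim: "(\<lambda>k. H i (Y k)) \<longlonglongrightarrow> H i x"
      using Y by (rule isCont_tendsto_compose)
    show "B i \<longlonglongrightarrow> (if H i x = 0 then norm (H' i x d) else (H i x \<bullet> H' i x d) / norm (H i x))"
    proof (cases "H i x = 0")
      case True
      then show ?thesis
        using tendsto_norm[OF H'lim] by (simp add: B_def[abs_def])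
    next
      case False
      have "(\<lambda>k. (H i (Y k) \<bullet> H' i (Y k) d) / sqrt ((norm (H i (Y k)))\<^sup>2 + (e k)\<^sup>2))
          \<longlonglongrightarrow> (H i x \<bullet> H' i x d) / sqrt ((norm (H i x))\<^sup>2 + 0\<^sup>2)"
        using False
        by (intro tendsto_divide tendsto_inner tendsto_real_sqrt tendsto_add tendsto_power
            tendsto_norm Hlim H'lim e) auto
      then show ?thesis
        using False by (simp add: B_def[abs_def])
    qed
  qed
  moreover have "(\<lambda>k. smooth' (e k) (Y k) d) \<longlonglongrightarrow> 0"
  proof (rule Lim_null_comparison)
    show "(\<lambda>k. norm d * norm (grad (smooth (e k)) (Y k))) \<longlonglongrightarrow> 0"
      using tendsto_mult_right_zero[OF g] .
    show "\<forall>\<^sub>F k in sequentially. norm (smooth' (e k) (Y k) d) \<le> norm d * norm (grad (smooth (e k)) (Y k))"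
      using C1_deriv_grad(2)[OF C1_deriv_smooth[OF e(2)]] Cauchy_Schwarz_ineq2
      by (auto intro!: always_eventually)
  qed
  moreover have "smooth' (e k) (Y k) d \<le> \<phi>' (Y k) d + (\<Sum>i\<in>I. B i k)" for k
    unfolding smooth'_def
  proof (intro add_left_mono sum_mono)
    fix i assume "i \<in> I"
    let ?u = "H i (Y k)" and ?v = "H' i (Y k) d"
    let ?s = "sqrt ((norm ?u)\<^sup>2 + (e k)\<^sup>2)"
    have "?u \<bullet> ?v \<le> norm ?u * norm ?v"
      by (rule norm_cauchy_schwarz)
    also have "\<dots> \<le> ?s * norm ?v"
      by (intro mult_right_mono) (auto simp: real_le_rsqrt)
    finally have "?u \<bullet> ?v \<le> norm ?v * ?s"
      by (simp add: mult.commute)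
    moreover have "0 < ?s"
      using e(2)[of k] by (simp add: add_nonneg_pos)
    ultimately have "(?u \<bullet> ?v) / ?s \<le> norm ?v"
      by (simp add: pos_divide_le_eq)
    then show "(?u \<bullet> ?v) / ?s \<le> B i k"
      by (simp add: B_def)
  qed
  ultimately have "0 \<le> ?D"
    by (intro LIMSEQ_le) auto
  also have "ereal ?D \<le> clarke_dir_deriv obj x d"
    by (rule clarke_dir_deriv_ge[OF obj_one_sided_derivative])
  finally show "ereal (0 \<bullet> d) \<le> clarke_dir_deriv obj x d"
    by (simp add: zero_ereal_def)
qed

end


section \<open>Runs of the algorithm\<close>

text \<open>
  A run without termination (tolerance \<open>0\<close> and infinitely many phases) on a coercive composite
  objective.
\<close>
locale smoothing_run = norm_composite \<phi> \<phi>' H H' I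
  for \<phi> :: "'a::euclidean_space \<Rightarrow> real" and \<phi>' :: "'a \<Rightarrow> 'a \<Rightarrow> real"
    and H :: "'i \<Rightarrow> 'a \<Rightarrow> 'b::real_inner" and H' :: "'i \<Rightarrow> 'a \<Rightarrow> 'a \<Rightarrow> 'b"
    and I :: "'i set" +
  fixes \<rho> \<eta> \<epsilon>\<^sub>0 a \<sigma> :: real and \<alpha> :: "nat \<Rightarrow> real" and X :: "nat \<Rightarrow> 'a" and \<epsilon> :: "nat \<Rightarrow> real"
  assumes coercive: "filterlim obj at_top at_infinity"
    and \<rho>: "0 < \<rho>" "\<rho> < 1" and \<eta>: "0 < \<eta>" "\<eta> < 1"
    and \<epsilon>\<^sub>0: "\<epsilon>\<^sub>0 > 0" and a: "a > 0" and \<sigma>: "\<sigma> > 0" and \<alpha>: "\<alpha> t > 0"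
    and run: "algorithm_run smooth \<rho> \<eta> \<epsilon>\<^sub>0 a \<sigma> \<alpha> 0 \<infinity> X \<epsilon>"
begin

abbreviation reduction :: "nat \<Rightarrow> bool" where
  "reduction \<equiv> reduction_criterion smooth \<eta> \<sigma> X \<epsilon>"

text \<open>
  With tolerance \<open>0\<close> a phase is executed as long as all earlier smoothing parameters are positive;
  their positivity is proved together with the execution of the phases.
\<close>
lemma run_unfold:
  "\<epsilon> 0 = \<epsilon>\<^sub>0"
  "(\<And>s. s < t \<Longrightarrow> 0 < \<epsilon> s) \<Longrightarrow>
     line_search (smooth (\<epsilon> t)) \<rho> a (\<alpha> t) (X t) (X (Suc t)) \<and>
     \<epsilon> (Suc t) = (if reduction t then \<eta> * \<epsilon> t else \<epsilon> t)"
proof -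
  show "\<epsilon> 0 = \<epsilon>\<^sub>0"
    using run by (simp add: algorithm_run_def)
  assume "\<And>s. s < t \<Longrightarrow> 0 < \<epsilon> s"
  then have "\<forall>s<t. \<not> \<sigma> * \<epsilon> s < 0"
    using \<sigma> by (simp add: not_less less_imp_le)
  then show "line_search (smooth (\<epsilon> t)) \<rho> a (\<alpha> t) (X t) (X (Suc t)) \<and>
      \<epsilon> (Suc t) = (if reduction t then \<eta> * \<epsilon> t else \<epsilon> t)"
    using run by (simp add: algorithm_run_def)
qed

lemma \<epsilon>_pos: "0 < \<epsilon> t"
proof (induction t rule: less_induct)
  case (less t)
  show ?case
  proof (cases t)
    case 0
    then show ?thesis
      using run_unfold(1) \<epsilon>\<^sub>0 by simp
  next
    case (Suc s)
    then have "0 < \<epsilon> s" "\<epsilon> t = (if reduction s then \<eta> * \<epsilon> s else \<epsilon> s)"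
      using run_unfold(2)[of s] less.IH by auto
    then show ?thesis
      using \<eta> by simp
  qed
qed

lemma run_line_search: "line_search (smooth (\<epsilon> t)) \<rho> a (\<alpha> t) (X t) (X (Suc t))"
  and \<epsilon>_Suc: "\<epsilon> (Suc t) = (if reduction t then \<eta> * \<epsilon> t else \<epsilon> t)"
  using run_unfold(2)[of t] \<epsilon>_pos by auto

lemma \<epsilon>_Suc_le: "\<epsilon> (Suc t) \<le> \<epsilon> t"
  using \<epsilon>_Suc[of t] \<epsilon>_pos[of t] \<eta> by (auto simp: mult_left_le_one_le)

lemma \<epsilon>_antimono: "s \<le> t \<Longrightarrow> \<epsilon> t \<le> \<epsilon> s"
  by (rule lift_Suc_antimono_le[of \<epsilon>, OF \<epsilon>_Suc_le])

text \<open>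
  Lowering the smoothing parameter raises the smoothed objective by at most the drop of
  \<open>card I * \<epsilon>\<close>, so the shifted values decrease along the whole run, and they dominate the
  nonsmooth objective.
\<close>
lemma obj_bounded_along_run: "obj (X t) \<le> smooth (\<epsilon> 0) (X 0) + real (card I) * \<epsilon> 0"
proof -
  have "smooth (\<epsilon> (Suc t)) (X (Suc t)) + real (card I) * \<epsilon> (Suc t)
      \<le> smooth (\<epsilon> t) (X t) + real (card I) * \<epsilon> t" for t
  proof -
    have "sufficient_decrease (smooth (\<epsilon> t)) a (X t) (X (Suc t))"
      using run_line_search[of t] by (auto simp: line_search_def)
    moreover have "0 \<le> 1 / a * (norm (X (Suc t) - X t))\<^sup>2"
      using a by simp
    ultimately have "smooth (\<epsilon> t) (X (Suc t)) \<le> smooth (\<epsilon> t) (X t)"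
      unfolding sufficient_decrease_def by linarith
    then show ?thesis
      using smooth_shifted_mono[of "\<epsilon> (Suc t)" "\<epsilon> t" "X (Suc t)"] \<epsilon>_Suc_le[of t] \<epsilon>_pos[of "Suc t"]
      by linarith
  qed
  then have "smooth (\<epsilon> t) (X t) + real (card I) * \<epsilon> t \<le> smooth (\<epsilon> 0) (X 0) + real (card I) * \<epsilon> 0"
    by (rule lift_Suc_antimono_le[of "\<lambda>t. smooth (\<epsilon> t) (X t) + real (card I) * \<epsilon> t"]) simp
  then show ?thesis
    using obj_le_smooth[of "X t" "\<epsilon> t"] by linarith
qed

lemma iterates_bounded:
  obtains R where "\<And>t. norm (X t) \<le> R"
proof -
  have "\<forall>\<^sub>F x in at_infinity. smooth (\<epsilon> 0) (X 0) + real (card I) * \<epsilon> 0 < obj x"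
    using coercive by (simp add: filterlim_at_top_dense)
  then obtain R where "\<And>x. R \<le> norm x \<Longrightarrow> smooth (\<epsilon> 0) (X 0) + real (card I) * \<epsilon> 0 < obj x"
    by (auto simp: eventually_at_infinity)
  then have "norm (X t) \<le> R" for t
    using obj_bounded_along_run[of t] by (meson linorder_not_less nle_le order_less_le_trans)
  then show thesis
    using that by blast
qed

text \<open>
  If the reduction criterion failed from some phase on, the algorithm would minimize one smooth
  function with gradients bounded away from \<open>0\<close> and step sizes bounded away from \<open>0\<close>, and each
  later phase would lower this function by a fixed amount.
\<close>
lemma infinitely_many_reductions:
  assumes bdd: "bdd_below (range obj)" and \<alpha>min: "\<alpha>min > 0" "\<And>t. \<alpha>min \<le> \<alpha> t"
  shows "infinite {t. reduction t}"
proof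
  assume "finite {t. reduction t}"
  then obtain s where s: "\<And>t. reduction t \<Longrightarrow> t < s"
    by (auto simp: finite_nat_set_iff_bounded)
  define e where "e = \<epsilon> s"
  have e: "e > 0" "\<epsilon> (s + k) = e" for k
    unfolding e_def by (rule \<epsilon>_pos) (induction k, use \<epsilon>_Suc s in \<open>auto simp: not_less\<close>)
  let ?f = "smooth e" and ?c = "\<sigma> * \<eta> * e"
  have c: "?c > 0"
    using \<sigma> \<eta> e by simp
  obtain R where R: "\<And>t. norm (X t) \<le> R"
    using iterates_bounded by blast
  obtain \<beta>\<^sub>0 where \<beta>\<^sub>0: "\<beta>\<^sub>0 > 0"
    "\<And>x \<beta>. norm x \<le> R \<Longrightarrow> ?c \<le> norm (grad ?f x) \<Longrightarrow> 0 < \<beta> \<Longrightarrow> \<beta> \<le> \<beta>\<^sub>0 \<Longrightarrow>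
       sufficient_decrease ?f a x (x - \<beta> *\<^sub>R grad ?f x)"
    using short_steps_accepted[OF cont_diffI[OF C1_deriv_smooth[OF e(1)]] a c, of R] by blast
  define b where "b = min \<alpha>min (\<rho> * \<beta>\<^sub>0)"
  have b: "b > 0"
    using \<alpha>min \<rho> \<beta>\<^sub>0 by (simp add: b_def)
  define m where "m = 1 / a * (b * ?c)\<^sup>2"
  have m: "m > 0"
    unfolding m_def by (intro mult_pos_pos divide_pos_pos zero_less_power a b c zero_less_one)
  have decrease: "?f (X (Suc t)) \<le> ?f (X t) - m" if t: "s < t" for t
  proof -
    obtain k where k: "t = Suc (s + k)"
      using t less_iff_Suc_add by auto
    have et: "\<epsilon> t = e"
      using e(2)[of "Suc k"] k by simp
    \<comment> \<open>The criterion of phase \<open>t - 1\<close> concerns the iterate \<open>X t\<close>; this is why \<open>t > s\<close> is needed.\<close>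
    have g: "?c \<le> norm (grad ?f (X t))"
      using s[of "s + k"] e(2)[of k] k by (force simp: reduction_criterion_def)
    obtain \<beta> where \<beta>: "min (\<alpha> t) (\<rho> * \<beta>\<^sub>0) \<le> \<beta>" "X (Suc t) = X t - \<beta> *\<^sub>R grad ?f (X t)"
      "sufficient_decrease ?f a (X t) (X (Suc t))"
      using line_search_step[OF run_line_search[of t] \<rho> \<alpha>, of \<beta>\<^sub>0] \<beta>\<^sub>0(2)[OF R g] unfolding et by blast
    have "b \<le> \<beta>"
      using \<beta>(1) \<alpha>min(2)[of t] by (auto simp: b_def)
    then have "b * ?c \<le> \<beta> * norm (grad ?f (X t))"
      using b c g by (intro mult_mono) auto
    also have "\<dots> = norm (X (Suc t) - X t)"
      using \<beta>(2) b \<open>b \<le> \<beta>\<close> by simp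
    finally have "m \<le> 1 / a * (norm (X (Suc t) - X t))\<^sup>2"
      unfolding m_def using a b c by (intro mult_left_mono power_mono) auto
    then show ?thesis
      using \<beta>(3) by (simp add: sufficient_decrease_def)
  qed
  have descent: "?f (X (Suc s + k)) \<le> ?f (X (Suc s)) - k * m" for k
  proof (induction k)
    case (Suc k)
    then show ?case
      using decrease[of "Suc s + k"] by (simp add: algebra_simps)
  qed simp
  obtain L where L: "\<And>x. L \<le> obj x"
    using bdd by (auto simp: bdd_below_def)
  obtain k :: nat where "?f (X (Suc s)) - (L - real (card I) * e) < k * m"
    using reals_Archimedean3[OF m] by blast
  then have "smooth e (X (Suc s + k)) + real (card I) * e < L"
    using descent[of k] by linarith
  then show False
    using obj_le_smooth[of "X (Suc s + k)" e] L[of "X (Suc s + k)"] by linarith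
qed

lemma \<epsilon>_reductions_tendsto_0:
  assumes "strict_mono r" and red: "\<And>l. reduction (r l)"
  shows "(\<lambda>l. \<epsilon> (r l)) \<longlonglongrightarrow> 0"
proof (rule tendsto_sandwich)
  have "\<epsilon> (r l) \<le> \<epsilon>\<^sub>0 * \<eta> ^ l" for l
  proof (induction l)
    case 0
    then show ?case
      using \<epsilon>_antimono[of 0 "r 0"] run_unfold(1) by simp
  next
    case (Suc l)
    have "\<epsilon> (r (Suc l)) \<le> \<epsilon> (Suc (r l))"
      using assms(1) by (intro \<epsilon>_antimono) (simp add: Suc_leI strict_monoD)
    also have "\<dots> = \<eta> * \<epsilon> (r l)"
      using \<epsilon>_Suc red by simp
    also have "\<dots> \<le> \<eta> * (\<epsilon>\<^sub>0 * \<eta> ^ l)"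
      using Suc.IH \<eta> by (intro mult_left_mono) auto
    finally show ?case
      by (simp add: mult_ac)
  qed
  then show "\<forall>\<^sub>F l in sequentially. \<epsilon> (r l) \<le> \<epsilon>\<^sub>0 * \<eta> ^ l"
    by simp
  show "\<forall>\<^sub>F l in sequentially. 0 \<le> \<epsilon> (r l)"
    using \<epsilon>_pos by (simp add: less_imp_le)
  show "(\<lambda>l. \<epsilon>\<^sub>0 * \<eta> ^ l) \<longlonglongrightarrow> 0"
    using \<eta> by (intro tendsto_mult_right_zero LIMSEQ_realpow_zero) auto
qed simp

lemma accumulation_point_exists: "\<exists>x. accumulation_point (\<lambda>l. X (Suc (r l))) x"
proof -
  obtain R where R: "\<And>t. norm (X t) \<le> R"
    using iterates_bounded by blast
  have "seq_compact (cball (0::'a) R)"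
    by (intro compact_imp_seq_compact compact_cball)
  moreover have "\<forall>l. X (Suc (r l)) \<in> cball 0 R"
    using R by simp
  ultimately obtain x q where "strict_mono q" "((\<lambda>l. X (Suc (r l))) \<circ> q) \<longlonglongrightarrow> x"
    by (rule seq_compactE)
  then show ?thesis
    by (auto simp: accumulation_point_def)
qed

lemma accumulation_point_stationary:
  assumes "strict_mono r" "\<And>l. reduction (r l)"
    and "accumulation_point (\<lambda>l. X (Suc (r l))) x"
  shows "clarke_stationary obj x"
proof -
  obtain q where q: "strict_mono q" "(\<lambda>k. X (Suc (r (q k)))) \<longlonglongrightarrow> x"
    using assms(3) by (auto simp: accumulation_point_def comp_def)
  have lim: "(\<lambda>k. \<epsilon> (r (q k))) \<longlonglongrightarrow> 0"
    using LIMSEQ_subseq_LIMSEQ[OF \<epsilon>_reductions_tendsto_0[OF assms(1,2)] q(1)] by (simp add: comp_def)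
  have "(\<lambda>k. norm (grad (smooth (\<epsilon> (r (q k)))) (X (Suc (r (q k)))))) \<longlonglongrightarrow> 0"
  proof (rule Lim_null_comparison)
    show "(\<lambda>k. \<sigma> * \<eta> * \<epsilon> (r (q k))) \<longlonglongrightarrow> 0"
      by (rule tendsto_mult_right_zero[OF lim])
    show "\<forall>\<^sub>F k in sequentially.
        norm (norm (grad (smooth (\<epsilon> (r (q k)))) (X (Suc (r (q k)))))) \<le> \<sigma> * \<eta> * \<epsilon> (r (q k))"
      using assms(2) by (simp add: reduction_criterion_def less_imp_le)
  qed
  then show ?thesis
    by (rule smoothing_limit_stationary[OF lim \<epsilon>_pos q(2)])
qed

end


section \<open>The joint reconstruction and synthesis objective\<close>

text \<open>The smooth part of the objective: data fidelity and synthesis terms.\<close>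
definition data_synthesis_terms ::
    "(complex^'n::finite \<Rightarrow> complex^'n) \<Rightarrow>
     complex^'n^'k1::finite \<Rightarrow> complex^'n^'k2::finite \<Rightarrow> complex^'k1 \<Rightarrow> complex^'k2 \<Rightarrow>
     (complex^'n \<Rightarrow> complex^'d::finite^'m::finite) \<Rightarrow> (complex^'n \<Rightarrow> complex^'d^'m) \<Rightarrow>
     (complex^('d + 'd)^'m \<Rightarrow> complex^'n) \<Rightarrow> real \<Rightarrow> 'n images \<Rightarrow> real" where
  "data_synthesis_terms F P\<^sub>1 P\<^sub>2 f\<^sub>1 f\<^sub>2 h\<^sub>1 h\<^sub>2 g \<gamma> x =
     (norm (P\<^sub>1 *v F (fst x) - f\<^sub>1))\<^sup>2 / 2 + (norm (P\<^sub>2 *v F (fst (snd x)) - f\<^sub>2))\<^sup>2 / 2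
     + \<gamma> / 2 * (norm (g (concat_channels (h\<^sub>1 (fst x)) (h\<^sub>2 (fst (snd x)))) - snd (snd x)))\<^sup>2"

text \<open>
  For \<open>i = (k, j)\<close> the feature vector of image number \<open>k\<close>, counted from \<open>0\<close>, at position \<open>j\<close>.
  Only \<open>k < 3\<close> occurs.
\<close>
definition feature_vector ::
    "(complex^'n::finite \<Rightarrow> complex^'d::finite^'m::finite) \<Rightarrow> (complex^'n \<Rightarrow> complex^'d^'m) \<Rightarrow>
     (complex^'n \<Rightarrow> complex^'d^'m) \<Rightarrow> nat \<times> 'm \<Rightarrow> 'n images \<Rightarrow> complex^'d" where
  "feature_vector h\<^sub>1 h\<^sub>2 h\<^sub>3 i x =
     (if fst i = 0 then h\<^sub>1 (fst x) else if fst i = 1 then h\<^sub>2 (fst (snd x)) else h\<^sub>3 (snd (snd x)))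
     $ snd i"

lemma cont_diff_images:
  "cont_diff (\<lambda>x::'n::finite images. fst x)"
  "cont_diff (\<lambda>x::'n images. fst (snd x))"
  "cont_diff (\<lambda>x::'n images. snd (snd x))"
  by (intro cont_diff_bounded_linear bounded_linear_fst bounded_linear_snd
      bounded_linear_fst_comp bounded_linear_snd_comp)+

lemma cont_diff_data_synthesis_terms:
  assumes "\<delta> > 0" "is_feature_net \<delta> w\<^sub>1 h\<^sub>1" "is_feature_net \<delta> w\<^sub>2 h\<^sub>2" "is_synthesis_net \<delta> \<theta> g"
  shows "cont_diff (data_synthesis_terms (dft N\<^sub>1 N\<^sub>2 pix) P\<^sub>1 P\<^sub>2 f\<^sub>1 f\<^sub>2 h\<^sub>1 h\<^sub>2 g \<gamma>)"
  unfolding data_synthesis_terms_def[abs_def] divide_inverse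
  by (intro cont_diff_add cont_diff_mult_left cont_diff_mult_right cont_diff_norm_power2
      cont_diff_diff cont_diff_matrix_vector_mult cont_diff_dft cont_diff_const
      cont_diff_synthesis_net[OF assms(1,4)] cont_diff_concat_channels
      cont_diff_feature_net[OF assms(1,2)] cont_diff_feature_net[OF assms(1,3)] cont_diff_images)

lemma cont_diff_feature_vector:
  assumes "\<delta> > 0" "is_feature_net \<delta> w\<^sub>1 h\<^sub>1" "is_feature_net \<delta> w\<^sub>2 h\<^sub>2" "is_feature_net \<delta> w\<^sub>3 h\<^sub>3"
  shows "cont_diff (feature_vector h\<^sub>1 h\<^sub>2 h\<^sub>3 i)"
proof -
  have *: "cont_diff (\<lambda>x::'a images. h\<^sub>1 (fst x) $ snd i)"
    "cont_diff (\<lambda>x::'a images. h\<^sub>2 (fst (snd x)) $ snd i)"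
    "cont_diff (\<lambda>x::'a images. h\<^sub>3 (snd (snd x)) $ snd i)"
    by (rule cont_diff_vec_nth cont_diff_images cont_diff_feature_net[OF assms(1,2)]
        cont_diff_feature_net[OF assms(1,3)] cont_diff_feature_net[OF assms(1,4)])+
  show ?thesis
    unfolding feature_vector_def[abs_def] by (cases "fst i = 0"; cases "fst i = 1") (simp_all add: *)
qed

text \<open>Both the norm and its smoothing are instances of \<open>N\<close>.\<close>
lemma joint_objective_eq_composite:
  "joint_objective (\<lambda>u. \<Sum>j\<in>UNIV. N (u $ j)) F P\<^sub>1 P\<^sub>2 f\<^sub>1 f\<^sub>2 h\<^sub>1 h\<^sub>2 h\<^sub>3 g \<gamma> x =
     data_synthesis_terms F P\<^sub>1 P\<^sub>2 f\<^sub>1 f\<^sub>2 h\<^sub>1 h\<^sub>2 g \<gamma> x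
     + (\<Sum>i\<in>{..<3} \<times> UNIV. N (feature_vector h\<^sub>1 h\<^sub>2 h\<^sub>3 i x))"
proof -
  have "(\<Sum>i\<in>{..<3} \<times> UNIV. N (feature_vector h\<^sub>1 h\<^sub>2 h\<^sub>3 i x))
      = (\<Sum>k<3. \<Sum>j\<in>UNIV. N (feature_vector h\<^sub>1 h\<^sub>2 h\<^sub>3 (k, j) x))"
    by (simp add: sum.cartesian_product)
  then show ?thesis
    by (simp add: joint_objective_def data_synthesis_terms_def feature_vector_def
        numeral_3_eq_3 split_beta)
qed

theorem theorem5p1:
  fixes N\<^sub>1 N\<^sub>2 :: nat and pix :: "'n::finite \<Rightarrow> nat \<times> nat"
    and P\<^sub>1 :: "complex^'n^'k1::finite" and P\<^sub>2 :: "complex^'n^'k2::finite"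
    and f\<^sub>1 :: "complex^'k1" and f\<^sub>2 :: "complex^'k2"
    and w\<^sub>1 w\<^sub>2 w\<^sub>3 \<theta> :: "conv list"
    and h\<^sub>1 h\<^sub>2 h\<^sub>3 :: "complex^'n \<Rightarrow> complex^'d::finite^'m::finite"
    and g :: "complex^('d + 'd)^'m \<Rightarrow> complex^'n"
    and \<delta> \<gamma> \<rho> \<eta> \<epsilon>\<^sub>0 a \<sigma> :: real and \<alpha> :: "nat \<Rightarrow> real"
    and \<Psi> :: "'n images \<Rightarrow> real" and \<Psi>\<epsilon> :: "real \<Rightarrow> 'n images \<Rightarrow> real"
    and X :: "nat \<Rightarrow> 'n images" and \<epsilon> :: "nat \<Rightarrow> real"
  assumes "pixel_grid N\<^sub>1 N\<^sub>2 pix"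
    and "undersampling P\<^sub>1" and "undersampling P\<^sub>2"
    and "\<delta> > 0" and "\<gamma> > 0"
    and "is_feature_net \<delta> w\<^sub>1 h\<^sub>1" and "is_feature_net \<delta> w\<^sub>2 h\<^sub>2" and "is_feature_net \<delta> w\<^sub>3 h\<^sub>3"
    and "is_synthesis_net \<delta> \<theta> g"
    and "\<Psi> = joint_objective norm21 (dft N\<^sub>1 N\<^sub>2 pix) P\<^sub>1 P\<^sub>2 f\<^sub>1 f\<^sub>2 h\<^sub>1 h\<^sub>2 h\<^sub>3 g \<gamma>"
    and "\<Psi>\<epsilon> = (\<lambda>e. joint_objective (smooth_norm21 e) (dft N\<^sub>1 N\<^sub>2 pix) P\<^sub>1 P\<^sub>2 f\<^sub>1 f\<^sub>2 h\<^sub>1 h\<^sub>2 h\<^sub>3 g \<gamma>)"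
    and "filterlim \<Psi> at_top at_infinity"
    and "bdd_below (range \<Psi>)"
    and "0 < \<rho>" and "\<rho> < 1" and "0 < \<eta>" and "\<eta> < 1"
    and "\<epsilon>\<^sub>0 > 0" and "a > 0" and "\<sigma> > 0" and "\<And>t. \<alpha> t > 0"
    and "algorithm_run \<Psi>\<epsilon> \<rho> \<eta> \<epsilon>\<^sub>0 a \<sigma> \<alpha> 0 \<infinity> X \<epsilon>"
  shows "((\<exists>\<alpha>min>0. \<forall>t. \<alpha>min \<le> \<alpha> t) \<longrightarrow> infinite {t. reduction_criterion \<Psi>\<epsilon> \<eta> \<sigma> X \<epsilon> t}) \<and>
         (\<forall>tl. strict_mono tl \<and> range tl = {t. reduction_criterion \<Psi>\<epsilon> \<eta> \<sigma> X \<epsilon> t} \<longrightarrow>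
            (\<exists>Xhat. accumulation_point (\<lambda>l. X (Suc (tl l))) Xhat) \<and>
            (\<forall>Xhat. accumulation_point (\<lambda>l. X (Suc (tl l))) Xhat \<longrightarrow> clarke_stationary \<Psi> Xhat))"
proof -
  define \<phi> where "\<phi> = data_synthesis_terms (dft N\<^sub>1 N\<^sub>2 pix) P\<^sub>1 P\<^sub>2 f\<^sub>1 f\<^sub>2 h\<^sub>1 h\<^sub>2 g \<gamma>"
  define H where "H = feature_vector h\<^sub>1 h\<^sub>2 h\<^sub>3"
  define I where "I = {..<3::nat} \<times> (UNIV :: 'm set)"
  obtain \<phi>' where \<phi>': "C1_deriv \<phi> \<phi>'"
    using cont_diff_data_synthesis_terms[OF assms(4,6,7,9)] unfolding \<phi>_def cont_diff_def by blast
  have "\<forall>i. \<exists>h'. C1_deriv (H i) h'"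
    using cont_diff_feature_vector[OF assms(4,6,7,8)] unfolding H_def cont_diff_def by blast
  then obtain H' where H': "\<And>i. C1_deriv (H i) (H' i)"
    by metis
  interpret norm_composite \<phi> \<phi>' H H' I
    using \<phi>' H' by unfold_locales (auto simp: I_def)
  have obj: "obj = \<Psi>"
    unfolding fun_eq_iff obj_def assms(10) norm21_def[abs_def] joint_objective_eq_composite
    by (simp add: \<phi>_def H_def I_def)
  have smooth: "smooth = \<Psi>\<epsilon>"
    unfolding fun_eq_iff smooth_def assms(11) smooth_norm21_def[abs_def]
      joint_objective_eq_composite[of "\<lambda>v. sqrt ((norm v)\<^sup>2 + e\<^sup>2) - e" for e]
    by (simp add: \<phi>_def H_def I_def)
  interpret smoothing_run \<phi> \<phi>' H H' I \<rho> \<eta> \<epsilon>\<^sub>0 a \<sigma> \<alpha> X \<epsilon>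
    using assms(12-22) by unfold_locales (simp_all add: obj smooth)
  show ?thesis
    using infinitely_many_reductions accumulation_point_exists accumulation_point_stationary assms(13)
    unfolding obj smooth by (metis (mono_tags, lifting) mem_Collect_eq rangeI)
qed

end
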